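(* Let $(\phi_t)_{t\ge0}$ be a semigroup in $\mathbb{D}$, not a group, with a parabolic petal $\Delta$, let $z\in\Delta$, and let $v_\Delta(t)=d_{\mathbb{D}}(z,\phi_t(z))$, $t\le0$, be the total speed of $\Delta$. Then there exists an absolute constant $c\ge1$ such that $$\frac1c\cdot\log|t|\le v_\Delta(t)\le c\cdot\log|t|,\qquad\text{for all } t<-1.$$
   Context: $\mathbb{D}$ is the unit disk, and $d_{\mathbb{D}}(z,w)=\operatorname{arctanh}\left|\frac{z-w}{1-\bar z w}\right|$ is its hyperbolic distance. A semigroup in $\mathbb{D}$ is a family $(\phi_t)_{t\ge0}$ of holomorphic self-maps of $\mathbb{D}$ with $\phi_0=\mathrm{id}$, $\phi_{t+s}=\phi_t\circ\phi_s$ for all $t,s\ge0$, and $\phi_t(z)\to z$ uniformly on compacta as $t\to0^+$. It is a group if for some (equivalently every) $t_0>0$ the map $\phi_{t_0}$ is an automorphism of $\mathbb{D}$. If it is not a group, there is a unique $\tau\in\overline{\mathbb{D}}$ (the Denjoy--Wolff point) with $\phi_t(z)\to\tau$ as $t\to+\infty$ for all $z\in\mathbb{D}$; the semigroup is elliptic if $\tau\in\mathbb{D}$ and non-elliptic if $\tau\in\partial\mathbb{D}$. The backward invariant set is $\mathcal{W}=\bigcap_{t\ge0}\phi_t(\mathbb{D})$. A petal is a non-empty connected component $\Delta$ of the interior of $\mathcal{W}$. Each $\phi_t$ ($t\ge0$) restricts to an automorphism of $\Delta$; for $z\in\Delta$ and $t\le0$ one writes $\phi_t(z):=(\phi_{-t}|_\Delta)^{-1}(z)$.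 A non-elliptic semigroup has a unique Koenigs function: a univalent holomorphic $h:\mathbb{D}\to\mathbb{C}$ with $h(0)=0$ and $h(\phi_t(z))=h(z)+t$ for all $z\in\mathbb{D}$, $t\ge0$. A petal $\Delta$ of a non-elliptic semigroup is parabolic if $h(\Delta)$ is a maximal horizontal half-plane in $h(\mathbb{D})$. Petals of elliptic semigroups are never parabolic.
   Formalization: As printed it fails as t→-1 (v_Δ(-1)>0=log 1). Proved: absolute c for all t<T, where T<-1 depends on semigroup, petal, z; also, for every T<-1, a constant depending on these and T gives the lower bound for all t<-1 and the upper bound for t≤T. *)

theory Defs
  imports "HOL-Complex_Analysis.Complex_Analysis"
begin

abbreviation unit_disc :: "complex set" where
  "unit_disc \<equiv> ball 0 1"

definition hyp_dist :: "complex \<Rightarrow> complex \<Rightarrow> real" where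
  "hyp_dist z w = artanh (cmod ((z - w) / (1 - cnj z * w)))"

text \<open>A semigroup is represented by a function on all of \<^typ>\<open>real\<close>, of which only the values at
  parameters \<open>t \<ge> 0\<close> and points of the unit disc are relevant.\<close>

definition hol_semigroup :: "(real \<Rightarrow> complex \<Rightarrow> complex) \<Rightarrow> bool" where
  "hol_semigroup \<phi> \<longleftrightarrow>
     (\<forall>t\<ge>0. \<phi> t holomorphic_on unit_disc \<and> \<phi> t ` unit_disc \<subseteq> unit_disc) \<and>
     (\<forall>z\<in>unit_disc. \<phi> 0 z = z) \<and>
     (\<forall>t\<ge>0. \<forall>s\<ge>0. \<forall>z\<in>unit_disc. \<phi> (t + s) z = \<phi> t (\<phi> s z)) \<and>
     (\<forall>K. compact K \<and> K \<subseteq> unit_disc \<longrightarrow> uniform_limit K \<phi> (\<lambda>z. z) (at_right 0))"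

definition disc_automorphism :: "(complex \<Rightarrow> complex) \<Rightarrow> bool" where
  "disc_automorphism f \<longleftrightarrow> f holomorphic_on unit_disc \<and> bij_betw f unit_disc unit_disc"

definition is_hol_group :: "(real \<Rightarrow> complex \<Rightarrow> complex) \<Rightarrow> bool" where
  "is_hol_group \<phi> \<longleftrightarrow> (\<exists>t>0. disc_automorphism (\<phi> t))"

definition denjoy_wolff_point :: "(real \<Rightarrow> complex \<Rightarrow> complex) \<Rightarrow> complex \<Rightarrow> bool" where
  "denjoy_wolff_point \<phi> \<tau> \<longleftrightarrow>
     \<tau> \<in> cball 0 1 \<and> (\<forall>z\<in>unit_disc. ((\<lambda>t. \<phi> t z) \<longlongrightarrow> \<tau>) at_top)"

definition non_elliptic :: "(real \<Rightarrow> complex \<Rightarrow> complex) \<Rightarrow> bool" where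
  "non_elliptic \<phi> \<longleftrightarrow> \<not> is_hol_group \<phi> \<and> (\<exists>\<tau>. denjoy_wolff_point \<phi> \<tau> \<and> \<tau> \<in> sphere 0 1)"

definition backward_invariant_set :: "(real \<Rightarrow> complex \<Rightarrow> complex) \<Rightarrow> complex set" where
  "backward_invariant_set \<phi> = (\<Inter>t\<in>{0..}. \<phi> t ` unit_disc)"

definition petal :: "(real \<Rightarrow> complex \<Rightarrow> complex) \<Rightarrow> complex set \<Rightarrow> bool" where
  "petal \<phi> \<Delta> \<longleftrightarrow> \<Delta> \<in> components (interior (backward_invariant_set \<phi>))"

definition petal_flow ::
    "(real \<Rightarrow> complex \<Rightarrow> complex) \<Rightarrow> complex set \<Rightarrow> real \<Rightarrow> complex \<Rightarrow> complex" where
  "petal_flow \<phi> \<Delta> t = (if 0 \<le> t then \<phi> t else inv_into \<Delta> (\<phi> (- t)))"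

text \<open>A predicate rather than a function: the Koenigs function is unique only on the unit disc,
  its values elsewhere being arbitrary.\<close>

definition koenigs_function ::
    "(real \<Rightarrow> complex \<Rightarrow> complex) \<Rightarrow> (complex \<Rightarrow> complex) \<Rightarrow> bool" where
  "koenigs_function \<phi> h \<longleftrightarrow>
     h holomorphic_on unit_disc \<and> inj_on h unit_disc \<and> h 0 = 0 \<and>
     (\<forall>z\<in>unit_disc. \<forall>t\<ge>0. h (\<phi> t z) = h z + of_real t)"

definition horizontal_half_plane :: "complex set \<Rightarrow> bool" where
  "horizontal_half_plane H \<longleftrightarrow> (\<exists>a. H = {w. Im w > a} \<or> H = {w. Im w < a})"

definition maximal_horizontal_half_plane :: "complex set \<Rightarrow> complex set \<Rightarrow> bool" where
  "maximal_horizontal_half_plane \<Omega> H \<longleftrightarrow>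
     horizontal_half_plane H \<and> H \<subseteq> \<Omega> \<and>
     (\<forall>H'. horizontal_half_plane H' \<and> H \<subseteq> H' \<and> H' \<subseteq> \<Omega> \<longrightarrow> H' = H)"

definition parabolic_petal :: "(real \<Rightarrow> complex \<Rightarrow> complex) \<Rightarrow> complex set \<Rightarrow> bool" where
  "parabolic_petal \<phi> \<Delta> \<longleftrightarrow>
     petal \<phi> \<Delta> \<and> non_elliptic \<phi> \<and>
     (\<exists>h. koenigs_function \<phi> h \<and> maximal_horizontal_half_plane (h ` unit_disc) (h ` \<Delta>))"

definition total_speed ::
    "(real \<Rightarrow> complex \<Rightarrow> complex) \<Rightarrow> complex set \<Rightarrow> complex \<Rightarrow> real \<Rightarrow> real" where
  "total_speed \<phi> \<Delta> z t = hyp_dist z (petal_flow \<phi> \<Delta> t z)"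

end

theory Submission
  imports Defs
begin

text \<open>
  Let \<open>h\<close> be the Koenigs function and \<open>\<Omega>\<close> its image. In the coordinate \<open>h\<close> the semigroup is
  translation by \<open>t\<close>, and the parabolic petal becomes a horizontal half-plane \<open>H \<subseteq> \<Omega>\<close>, which is
  invariant under translation in both directions. So the backward orbit of \<open>z\<close> is the point \<open>\<zeta>\<close> of
  the disc with \<open>h \<zeta> = h z + t\<close> (\<open>koenigs_petal_flow\<close>), and the theorem compares the hyperbolic
  distance of \<open>h z\<close> and \<open>h z + t\<close> in \<open>\<Omega>\<close> with that in two simpler domains, one inside \<open>\<Omega>\<close> and one
  around it. Both comparisons are instances of the Schwarz-Pick lemma.

  Upper bound (\<open>hyp_dist_le_log_of_half_plane_in_image\<close>): since \<open>H \<subseteq> \<Omega>\<close>, the distance in \<open>\<Omega>\<close> is at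
  most that in \<open>H\<close>. If \<open>r\<close> is the distance of \<open>h z\<close> to the boundary line of \<open>H\<close>, the distance in
  \<open>H\<close> is \<open>arsinh (\<bar>t\<bar> / (2 r)) \<le> ln (1 + \<bar>t\<bar> / r)\<close>, so it is at most \<open>ln \<bar>t\<bar> + B\<close> for \<open>\<bar>t\<bar> > 1\<close>.

  Lower bound (\<open>hyp_dist_ge_log_of_slit_omitted\<close>): as \<open>H\<close> is maximal, \<open>\<Omega>\<close> omits some point \<open>p\<close>. As
  \<open>\<Omega>\<close> is invariant under translation to the right, it then omits the whole ray
  \<open>{p - s | s. s \<ge> 0}\<close>. Hence the principal branch of \<open>sqrt (h - p)\<close> maps the disc into the right half-plane,
  and it takes \<open>\<zeta>\<close> to a point of modulus about \<open>sqrt \<bar>t\<bar>\<close>. In the right half-plane the distance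
  from a fixed point to one of modulus \<open>R\<close> is at least \<open>ln R / 2 - C\<close>, which gives
  \<open>ln \<bar>t\<bar> / 4 - C\<close>. This replaces the Koebe distortion theorem, which would give the
  same exponent from univalence alone.

  The additive constants depend on the semigroup, the petal and \<open>z\<close>, but the factors \<open>1/4\<close> and
  \<open>1\<close> of \<open>ln \<bar>t\<bar>\<close> do not. For large \<open>\<bar>t\<bar>\<close> the additive constants are absorbed by passing to the
  factors \<open>1/8\<close> and \<open>8\<close>. On the remaining bounded range of \<open>t\<close> the factor is not
  absolute: below, it depends on how far the speed stays away from zero for \<open>t < -1\<close>, and above,
  on how far \<open>t\<close> stays away from \<open>-1\<close> (\<open>log_comparison\<close>).
\<close>

section \<open>The Schwarz-Pick lemma between the disc and the right half-plane\<close>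

lemma nonzero_of_Re_pos: "Re x > 0 \<Longrightarrow> x \<noteq> 0"
  by auto

lemma one_minus_cayley_norm_squared:
  assumes "Re a > 0" "Re u > 0"
  shows "1 - (cmod ((u - a) / (u + cnj a)))\<^sup>2 = 4 * Re a * Re u / (cmod (u + cnj a))\<^sup>2"
proof -
  have "Re (u + cnj a) > 0" using assms by simp
  then have "u + cnj a \<noteq> 0" by (rule nonzero_of_Re_pos)
  then have nz: "(cmod (u + cnj a))\<^sup>2 \<noteq> 0" by simp
  have "(cmod (u + cnj a))\<^sup>2 - (cmod (u - a))\<^sup>2 = 4 * Re a * Re u"
    unfolding cmod_power2 by (simp add: power2_eq_square algebra_simps)
  then show ?thesis
    using nz by (simp add: norm_divide power_divide divide_simps)
qed

lemma cayley_norm_less_1: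
  assumes "Re a > 0" "Re u > 0"
  shows "cmod ((u - a) / (u + cnj a)) < 1"
proof -
  have "Re (u + cnj a) > 0" using assms by simp
  then have "u + cnj a \<noteq> 0" by (rule nonzero_of_Re_pos)
  then have "1 - (cmod ((u - a) / (u + cnj a)))\<^sup>2 > 0"
    using assms unfolding one_minus_cayley_norm_squared[OF assms] by simp
  then have "(cmod ((u - a) / (u + cnj a)))\<^sup>2 < 1\<^sup>2" by simp
  then show ?thesis by (rule power_less_imp_less_base) simp
qed

text \<open>The Schwarz lemma is applied to \<open>f\<close> between the disc automorphism that moves \<open>0\<close> to \<open>z\<close> and
  the Cayley transform that moves \<open>f z\<close> to \<open>0\<close>. The quotient on the left is the
  pseudo-hyperbolic distance of the right half-plane.\<close>

lemma schwarz_pick_disc_to_half_plane: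
  assumes holf: "f holomorphic_on unit_disc"
    and pos: "\<And>x. x \<in> unit_disc \<Longrightarrow> Re (f x) > 0"
    and z: "z \<in> unit_disc" and w: "w \<in> unit_disc"
  shows "cmod ((f w - f z) / (f w + cnj (f z))) \<le> cmod ((w - z) / (1 - cnj z * w))"
proof -
  define m where "m = Moebius_function 0 (- z)"
  define F where "F x = (f (m x) - f z) / (f (m x) + cnj (f z))" for x
  define \<xi> where "\<xi> = Moebius_function 0 z w"
  have mD: "m x \<in> unit_disc" if "x \<in> unit_disc" for x
    using Moebius_function_norm_lt_1[of "- z" x 0] z that by (simp add: m_def)
  have holm: "m holomorphic_on unit_disc"
    unfolding m_def by (rule Moebius_function_holomorphic) (use z in simp)
  have "(f \<circ> m) holomorphic_on unit_disc"
    by (rule holomorphic_on_compose_gen[OF holm holf]) (use mD in auto)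
  then have holfm: "(\<lambda>x. f (m x)) holomorphic_on unit_disc" by (simp add: o_def)
  have "f (m x) + cnj (f z) \<noteq> 0" if "x \<in> unit_disc" for x
  proof -
    have "Re (f (m x) + cnj (f z)) > 0" using pos[OF mD[OF that]] pos[OF z] by simp
    then show ?thesis by (rule nonzero_of_Re_pos)
  qed
  then have "F holomorphic_on unit_disc"
    unfolding F_def by (intro holomorphic_intros holfm) auto
  moreover have "F 0 = 0"
    by (simp add: F_def m_def Moebius_function_of_zero)
  moreover have "cmod (F x) < 1" if "cmod x < 1" for x
    unfolding F_def by (rule cayley_norm_less_1) (use pos mD z that in auto)
  moreover have "cmod \<xi> < 1"
    unfolding \<xi>_def by (rule Moebius_function_norm_lt_1) (use z w in auto)
  ultimately have "cmod (F \<xi>) \<le> cmod \<xi>" by (rule Schwarz_Lemma(1))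
  moreover have "m \<xi> = w"
    unfolding m_def \<xi>_def by (rule Moebius_function_compose) (use z w in auto)
  ultimately show ?thesis by (simp add: F_def \<xi>_def Moebius_function_simple)
qed

lemma schwarz_pick_half_plane_to_disc:
  assumes holg: "g holomorphic_on {u. Re u > 0}"
    and disc: "\<And>u. Re u > 0 \<Longrightarrow> g u \<in> unit_disc"
    and a: "Re a > 0" and b: "Re b > 0"
  shows "cmod ((g b - g a) / (1 - cnj (g a) * g b)) \<le> cmod ((b - a) / (b + cnj a))"
proof -
  \<comment> \<open>the inverse of the Cayley transform \<open>u \<mapsto> (u - a) / (u + cnj a)\<close>\<close>
  define k where "k x = (a + cnj a * x) / (1 - x)" for x
  define F where "F x = Moebius_function 0 (g a) (g (k x))" for x
  define \<xi> where "\<xi> = (b - a) / (b + cnj a)"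
  have k_pos: "Re (k x) > 0" if "cmod x < 1" for x
  proof -
    have ne: "1 - x \<noteq> 0" using that by auto
    have "(cmod x)\<^sup>2 < 1" using that by (simp add: abs_square_less_1)
    have "k x = ((a + cnj a * x) * cnj (1 - x)) / of_real ((cmod (1 - x))\<^sup>2)"
      using ne unfolding k_def
      by (subst complex_div_cnj) (simp add: complex_mult_cnj cmod_power2)
    then have "Re (k x) = Re ((a + cnj a * x) * cnj (1 - x)) / (cmod (1 - x))\<^sup>2"
      by (metis Re_divide_of_real)
    also have "Re ((a + cnj a * x) * cnj (1 - x)) = Re a * (1 - (cmod x)\<^sup>2)"
      unfolding cmod_power2 by (simp add: algebra_simps power2_eq_square)
    finally show ?thesis using a \<open>(cmod x)\<^sup>2 < 1\<close> ne by simp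
  qed
  have "k holomorphic_on unit_disc"
    unfolding k_def by (intro holomorphic_intros) auto
  then have "(g \<circ> k) holomorphic_on unit_disc"
    by (rule holomorphic_on_compose_gen[OF _ holg]) (use k_pos in auto)
  then have "(Moebius_function 0 (g a) \<circ> (g \<circ> k)) holomorphic_on unit_disc"
    by (rule holomorphic_on_compose_gen[OF _ Moebius_function_holomorphic])
      (use disc a k_pos in auto)
  then have "F holomorphic_on unit_disc" by (simp add: F_def[abs_def] o_def)
  moreover have "F 0 = 0"
    by (simp add: F_def k_def Moebius_function_eq_zero)
  moreover have "cmod (F x) < 1" if "cmod x < 1" for x
    unfolding F_def by (rule Moebius_function_norm_lt_1) (use disc a k_pos that in auto)
  moreover have "cmod \<xi> < 1"
    unfolding \<xi>_def by (rule cayley_norm_less_1[OF a b])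
  ultimately have "cmod (F \<xi>) \<le> cmod \<xi>" by (rule Schwarz_Lemma(1))
  moreover have "k \<xi> = b"
  proof -
    have "Re (b + cnj a) > 0" "Re (a + cnj a) > 0" using a b by simp_all
    then have "b + cnj a \<noteq> 0" and "a + cnj a \<noteq> 0"
      using nonzero_of_Re_pos by blast+
    then have "a + cnj a * \<xi> = b * (a + cnj a) / (b + cnj a)"
      and "1 - \<xi> = (a + cnj a) / (b + cnj a)"
      by (simp_all add: \<xi>_def divide_simps) (simp_all add: algebra_simps)
    with \<open>b + cnj a \<noteq> 0\<close> \<open>a + cnj a \<noteq> 0\<close> show ?thesis by (simp add: k_def)
  qed
  ultimately show ?thesis by (simp add: F_def \<xi>_def Moebius_function_simple)
qed

section \<open>Estimates for the inverse hyperbolic tangent\<close>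

lemma artanh_mono_real:
  fixes x y :: real
  assumes "0 \<le> x" "x \<le> y" "y < 1"
  shows "artanh x \<le> artanh y"
proof -
  have "(1 + x) / (1 - x) \<le> (1 + y) / (1 - y)"
    using assms by (intro frac_le) auto
  moreover have "(1 + x) / (1 - x) > 0" using assms by simp
  ultimately show ?thesis unfolding artanh_def by (simp add: ln_mono)
qed

lemma artanh_ge_half:
  fixes x :: real
  assumes "0 \<le> x" "x < 1"
  shows "x / 2 \<le> artanh x"
proof -
  have "ln (1 - x) \<le> - x" using ln_le_minus_one[of "1 - x"] assms by simp
  moreover have "ln (1 + x) \<ge> 0" using assms by simp
  moreover have "artanh x = (ln (1 + x) - ln (1 - x)) / 2"
    using assms by (simp add: artanh_def ln_div)
  moreover have "x \<le> A - B" if "B \<le> - x" "0 \<le> A" for A B :: real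
    using that by linarith
  ultimately show ?thesis by (metis divide_right_mono zero_le_numeral)
qed

text \<open>In the half-plane, \<open>1 - x\<^sup>2\<close> has a closed form for the pseudo-hyperbolic distance \<open>x\<close>
  (\<open>one_minus_cayley_norm_squared\<close>), which makes this the convenient lower bound near \<open>x = 1\<close>.\<close>

lemma artanh_ge_log_defect:
  fixes x :: real
  assumes "0 \<le> x" "x < 1"
  shows "- ln (1 - x\<^sup>2) / 2 \<le> artanh x"
proof -
  have "1 - x\<^sup>2 = (1 - x) * (1 + x)" by (simp add: power2_eq_square algebra_simps)
  then have "ln (1 - x\<^sup>2) = ln (1 - x) + ln (1 + x)"
    using assms by (simp add: ln_mult)
  moreover have "ln (1 + x) \<ge> 0" using assms by simp
  ultimately show ?thesis using assms by (simp add: artanh_def ln_div)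
qed

text \<open>The bound on \<open>x\<close> is the pseudo-hyperbolic distance of two points at height \<open>r\<close> above the
  boundary of a half-plane and at horizontal distance \<open>s\<close>.\<close>

lemma artanh_le_log:
  fixes x r s :: real
  assumes "r > 0" "s \<ge> 0" "0 \<le> x" "x \<le> s / sqrt (4 * r\<^sup>2 + s\<^sup>2)"
  shows "artanh x \<le> ln (1 + s / r)"
proof -
  define q where "q = sqrt (4 * r\<^sup>2 + s\<^sup>2)"
  have q2: "q\<^sup>2 = 4 * r\<^sup>2 + s\<^sup>2" and q0: "q \<ge> 0" by (simp_all add: q_def)
  have "s\<^sup>2 < q\<^sup>2" using assms q2 by simp
  then have sq: "s < q" using q0 by (rule power_less_imp_less_base)
  have "q\<^sup>2 \<le> (2 * r + s)\<^sup>2" using q2 assms by (simp add: power2_sum)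
  then have qle: "q \<le> 2 * r + s" by (rule power2_le_imp_le) (use assms(1,2) in simp)
  have "artanh x \<le> artanh (s / q)"
  proof (rule artanh_mono_real)
    show "0 \<le> x" "x \<le> s / q" using assms(3,4) by (simp_all only: q_def)
    show "s / q < 1" using sq assms(2) by simp
  qed
  also have "artanh (s / q) = ln (((q + s) / (2 * r))\<^sup>2) / 2"
  proof -
    have "(q - s) * (q + s) = 4 * r\<^sup>2"
      using q2 by (simp add: power2_eq_square algebra_simps)
    moreover have "(1 + s / q) / (1 - s / q) = (q + s) / (q - s)"
      using sq assms(2) by (simp add: field_simps)
    moreover have "\<dots> = (q + s)\<^sup>2 / ((q - s) * (q + s))"
      using sq assms(2) by (simp add: power2_eq_square)
    ultimately have "(1 + s / q) / (1 - s / q) = ((q + s) / (2 * r))\<^sup>2"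
      by (simp add: power_divide power_mult_distrib)
    then show ?thesis by (simp add: artanh_def)
  qed
  also have "\<dots> = ln ((q + s) / (2 * r))"
    using sq assms(1,2) by (subst ln_realpow) auto
  also have "\<dots> \<le> ln (1 + s / r)"
  proof (rule ln_mono)
    have "(q + s) / (2 * r) \<le> (2 * r + 2 * s) / (2 * r)"
      using qle assms(1) by (intro divide_right_mono) auto
    then show "(q + s) / (2 * r) \<le> 1 + s / r" using assms(1) by (simp add: add_divide_distrib)
  qed (use sq assms(1,2) in simp)
  finally show ?thesis .
qed

section \<open>The distance bounds for holomorphic maps of the disc\<close>

text \<open>Here \<open>a\<close> and \<open>b\<close> are square roots of two points of a slit plane at distance \<open>s\<close>. From
  \<open>\<bar>b\<bar>\<^sup>2 \<le> \<bar>a\<bar>\<^sup>2 + s\<close> both roots have modulus at most \<open>R = sqrt (M s)\<close>, and the factorisation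
  \<open>\<bar>a - b\<bar> \<bar>a + b\<bar> = s\<close> then forces \<open>\<bar>a - b\<bar> \<ge> s / (2 R)\<close>. This one estimate gives both claims: it bounds
  \<open>\<rho>\<close> below, and it bounds the denominator of \<open>1 - \<rho>\<^sup>2 = 4 Re a Re b / \<bar>b + cnj a\<bar>\<^sup>2\<close> below because
  \<open>\<bar>b + cnj a\<bar> \<ge> \<bar>b - a\<bar>\<close>, so that \<open>1 - \<rho>\<^sup>2\<close> is at most \<open>16 M\<^sup>2 / sqrt s\<close>.\<close>

lemma half_plane_distance_of_square_roots:
  fixes a b :: complex and s :: real
  assumes a: "Re a > 0" and b: "Re b > 0" and s: "s \<ge> 1" and ab: "cmod (a\<^sup>2 - b\<^sup>2) = s"
  defines "M \<equiv> 1 + (cmod a)\<^sup>2"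
  defines "\<rho> \<equiv> cmod ((b - a) / (b + cnj a))"
  shows "1 / (8 * M) \<le> artanh \<rho>" and "ln s / 4 - ln (4 * M) \<le> artanh \<rho>"
proof -
  have M: "M \<ge> 1" by (simp add: M_def)
  have \<rho>: "0 \<le> \<rho>" "\<rho> < 1"
    using cayley_norm_less_1[OF a b] by (simp_all add: \<rho>_def)
  define R where "R = sqrt (M * s)"
  have R2: "R\<^sup>2 = M * s" using M s by (simp add: R_def)
  have Rpos: "R > 0" using M s by (simp add: R_def)
  have a2: "(cmod a)\<^sup>2 \<le> M * s" using M s mult_mono[of "(cmod a)\<^sup>2" M 1 s] by (simp add: M_def)
  have "(cmod b)\<^sup>2 \<le> (cmod a)\<^sup>2 + cmod (a\<^sup>2 - b\<^sup>2)"
    using norm_triangle_ineq4[of "a\<^sup>2" "a\<^sup>2 - b\<^sup>2"] by (simp add: norm_power)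
  also have "\<dots> \<le> (cmod a)\<^sup>2 * s + s" using ab s mult_left_mono[of 1 s "(cmod a)\<^sup>2"] by simp
  also have "\<dots> = M * s" by (simp add: M_def algebra_simps)
  finally have b2: "(cmod b)\<^sup>2 \<le> M * s" .
  have aR: "cmod a \<le> R" and bR: "cmod b \<le> R"
    unfolding R_def using a2 b2 by (simp_all add: real_le_rsqrt)
  have diff: "s \<le> cmod (b - a) * (2 * R)"
  proof -
    have "a\<^sup>2 - b\<^sup>2 = - ((b - a) * (a + b))" by (simp add: power2_eq_square algebra_simps)
    then have "s = cmod (b - a) * cmod (a + b)" using ab by (metis norm_minus_cancel norm_mult)
    moreover have "cmod (a + b) \<le> 2 * R" using norm_triangle_ineq[of a b] aR bR by simp
    ultimately show ?thesis by (simp add: mult_left_mono)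
  qed
  have sum_le: "cmod (b + cnj a) \<le> 2 * R"
    using norm_triangle_ineq[of b "cnj a"] aR bR by simp
  have "Re (b + cnj a) > 0" using a b by simp
  then have ne: "b + cnj a \<noteq> 0" by (rule nonzero_of_Re_pos)
  then have sum_pos: "cmod (b + cnj a) > 0" by simp
  have diff_le: "cmod (b - a) \<le> cmod (b + cnj a)"
    using \<rho>(2) sum_pos by (simp add: \<rho>_def norm_divide divide_simps split: if_splits)
  show "1 / (8 * M) \<le> artanh \<rho>"
  proof -
    have "1 / (8 * M) = (s / (2 * R)) / (2 * R) / 2"
      using R2 Rpos M s by (simp add: field_simps power2_eq_square)
    also have "\<dots> \<le> cmod (b - a) / cmod (b + cnj a) / 2"
    proof (intro divide_right_mono frac_le)
      show "s / (2 * R) \<le> cmod (b - a)" using diff Rpos by (simp add: field_simps)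
    qed (use sum_le sum_pos s in auto)
    also have "\<dots> = \<rho> / 2" by (simp add: \<rho>_def norm_divide)
    also have "\<dots> \<le> artanh \<rho>" using \<rho> by (rule artanh_ge_half)
    finally show ?thesis .
  qed
  show "ln s / 4 - ln (4 * M) \<le> artanh \<rho>"
  proof -
    have "s / (2 * R) \<le> cmod (b + cnj a)"
    proof -
      have "s \<le> cmod (b + cnj a) * (2 * R)"
        using order_trans[OF diff mult_right_mono[OF diff_le, of "2 * R"]] Rpos by simp
      then show ?thesis using Rpos by (simp add: field_simps)
    qed
    then have lower: "(s / (2 * R))\<^sup>2 \<le> (cmod (b + cnj a))\<^sup>2"
      using s Rpos by (intro power_mono) auto
    have "Re b \<le> R" using bR complex_Re_le_cmod[of b] by simp
    moreover have "Re a \<le> sqrt M"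
    proof -
      have "cmod a \<le> sqrt M" by (rule real_le_rsqrt) (simp add: M_def)
      then show ?thesis using complex_Re_le_cmod[of a] by simp
    qed
    ultimately have num: "4 * Re a * Re b \<le> 4 * sqrt M * R"
      using a b M by (intro mult_mono) auto
    have "1 - \<rho>\<^sup>2 = 4 * Re a * Re b / (cmod (b + cnj a))\<^sup>2"
      unfolding \<rho>_def by (rule one_minus_cayley_norm_squared[OF a b])
    also have "\<dots> \<le> 4 * sqrt M * R / (s / (2 * R))\<^sup>2"
      using num lower a b s Rpos M by (intro frac_le) auto
    also have "\<dots> = 16 * M\<^sup>2 / sqrt s"
    proof -
      have "4 * sqrt M * R / (s / (2 * R))\<^sup>2 = 16 * sqrt M * R * R\<^sup>2 / s\<^sup>2"
        using Rpos s by (simp add: power_divide power_mult_distrib)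
      also have "\<dots> = 16 * M * (sqrt M * sqrt M) * (sqrt s / s)"
        unfolding R2 using s by (simp add: R_def real_sqrt_mult power2_eq_square)
      also have "\<dots> = 16 * M\<^sup>2 / sqrt s"
        using M s by (simp add: power2_eq_square sqrt_divide_self_eq inverse_eq_divide)
      finally show ?thesis .
    qed
    finally have le: "1 - \<rho>\<^sup>2 \<le> 16 * M\<^sup>2 / sqrt s" .
    have "\<rho>\<^sup>2 < 1" using \<rho> by (simp add: abs_square_less_1)
    then have "ln (1 - \<rho>\<^sup>2) \<le> ln (16 * M\<^sup>2 / sqrt s)" using le by (simp add: ln_mono)
    also have "\<dots> = ln ((4 * M)\<^sup>2) - ln (sqrt s)"
      using M s by (simp add: ln_div power_mult_distrib)
    also have "ln ((4 * M)\<^sup>2) = 2 * ln (4 * M)"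
      using M by (subst ln_realpow) auto
    also have "ln (sqrt s) = ln s / 2"
      using s by (simp add: ln_sqrt)
    finally show ?thesis using artanh_ge_log_defect[OF \<rho>] by simp
  qed
qed

text \<open>The omitted ray allows a branch of \<open>sqrt (h - p)\<close> with values in the right half-plane;
  Schwarz-Pick for this branch transports the preceding estimate to the disc. The two bounds
  cover different ranges: the logarithmic one may be negative when \<open>h w\<close> is not far from \<open>h z\<close>, where
  \<open>\<delta>\<close> is still positive.\<close>

lemma hyp_dist_ge_log_of_slit_omitted:
  assumes holh: "h holomorphic_on unit_disc"
    and omit: "\<And>x s. x \<in> unit_disc \<Longrightarrow> s \<ge> 0 \<Longrightarrow> h x \<noteq> p - of_real s"
    and z: "z \<in> unit_disc"
  obtains \<delta> C where "\<delta> > 0" "C \<ge> 0"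
    "\<And>w. w \<in> unit_disc \<Longrightarrow> cmod (h z - h w) \<ge> 1 \<Longrightarrow> \<delta> \<le> hyp_dist z w"
    "\<And>w. w \<in> unit_disc \<Longrightarrow> cmod (h z - h w) \<ge> 1 \<Longrightarrow>
        ln (cmod (h z - h w)) / 4 - C \<le> hyp_dist z w"
proof -
  define S where "S x = csqrt (h x - p)" for x
  define M where "M = 1 + (cmod (S z))\<^sup>2"
  have slit: "h x - p \<notin> \<real>\<^sub>\<le>\<^sub>0" if "x \<in> unit_disc" for x
  proof
    assume "h x - p \<in> \<real>\<^sub>\<le>\<^sub>0"
    then obtain r where "r \<le> 0" "h x - p = of_real r" by (auto elim: nonpos_Reals_cases)
    then show False using omit[OF that, of "- r"] by (simp add: algebra_simps)
  qed
  have holS: "S holomorphic_on unit_disc"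
    unfolding S_def by (intro holomorphic_intros holh slit)
  have posS: "Re (S x) > 0" if "x \<in> unit_disc" for x
  proof -
    have "Re (S x) \<noteq> 0"
    proof
      assume "Re (S x) = 0"
      then have "h x - p = - of_real ((Im (S x))\<^sup>2)"
        using power2_csqrt[of "h x - p", folded S_def]
        by (simp add: complex_eq_iff Re_power2 Im_power2 del: power2_csqrt)
      then show False using omit[OF that, of "(Im (S x))\<^sup>2"] by (simp add: algebra_simps)
    qed
    then show ?thesis using Re_csqrt[of "h x - p"] by (simp add: S_def)
  qed
  have M: "M \<ge> 1" by (simp add: M_def)
  have bounds: "1 / (8 * M) \<le> hyp_dist z w \<and> ln (cmod (h z - h w)) / 4 - ln (4 * M) \<le> hyp_dist z w"
    if w: "w \<in> unit_disc" and far: "cmod (h z - h w) \<ge> 1" for w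
  proof -
    define \<rho> where "\<rho> = cmod ((S w - S z) / (S w + cnj (S z)))"
    have "\<rho> \<le> cmod ((w - z) / (1 - cnj z * w))"
      unfolding \<rho>_def by (rule schwarz_pick_disc_to_half_plane[OF holS posS z w])
    moreover have "cmod ((w - z) / (1 - cnj z * w)) < 1"
      using Moebius_function_norm_lt_1[of z w 0] z w by (simp add: Moebius_function_simple)
    ultimately have "artanh \<rho> \<le> hyp_dist z w"
      unfolding hyp_dist_def norm_divide norm_minus_commute[of z w]
      by (intro artanh_mono_real) (auto simp: \<rho>_def)
    moreover have "cmod ((S z)\<^sup>2 - (S w)\<^sup>2) = cmod (h z - h w)" by (simp add: S_def)
    ultimately show ?thesis
      using half_plane_distance_of_square_roots[OF posS[OF z] posS[OF w] far, folded M_def \<rho>_def]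
      by fastforce
  qed
  show ?thesis
    by (rule that[of "1 / (8 * M)" "ln (4 * M)"]) (use bounds M in auto)
qed

text \<open>Schwarz-Pick for the inverse of \<open>h\<close> on the half-plane \<open>H\<close>; the constant \<open>r\<close> found in the
  proof is the distance of \<open>h z\<close> to the boundary of \<open>H\<close>.\<close>

lemma hyp_dist_le_log_of_half_plane_in_image:
  assumes holh: "h holomorphic_on unit_disc" and inj: "inj_on h unit_disc"
    and H: "horizontal_half_plane H" "H \<subseteq> h ` unit_disc"
    and z: "z \<in> unit_disc" "h z \<in> H"
  obtains r where "r > 0"
    "\<And>w t. w \<in> unit_disc \<Longrightarrow> h w = h z + of_real t \<Longrightarrow> hyp_dist z w \<le> ln (1 + \<bar>t\<bar> / r)"
proof -
  \<comment> \<open>The sign \<open>\<sigma>\<close> treats upper and lower half-planes at once.\<close>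
  obtain \<alpha> \<sigma> :: real where \<sigma>: "\<sigma> = 1 \<or> \<sigma> = - 1" and H_eq: "H = {w. \<sigma> * (Im w - \<alpha>) > 0}"
  proof -
    obtain \<alpha> where "H = {w. Im w > \<alpha>} \<or> H = {w. Im w < \<alpha>}"
      using H(1) unfolding horizontal_half_plane_def by blast
    then show ?thesis
      using that[of 1 \<alpha>] that[of "- 1" \<alpha>] by auto
  qed
  obtain g where holg: "g holomorphic_on (h ` unit_disc)" and g: "\<And>x. x \<in> unit_disc \<Longrightarrow> g (h x) = x"
    using holomorphic_has_inverse[OF holh open_ball inj] by metis
  \<comment> \<open>\<open>e\<close> maps the right half-plane onto \<open>H\<close>\<close>
  define e where "e u = \<i> * of_real \<sigma> * u + \<i> * of_real \<alpha>" for u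
  define G where "G u = g (e u)" for u
  have eH: "e u \<in> H" if "Re u > 0" for u
    using that \<sigma> by (auto simp: H_eq e_def)
  have "e holomorphic_on {u. Re u > 0}" unfolding e_def by (intro holomorphic_intros)
  then have "(g \<circ> e) holomorphic_on {u. Re u > 0}"
    by (rule holomorphic_on_compose_gen[OF _ holg]) (use eH H(2) in auto)
  then have holG: "G holomorphic_on {u. Re u > 0}" by (simp add: G_def[abs_def] o_def)
  have discG: "G u \<in> unit_disc" if "Re u > 0" for u
  proof -
    obtain x where "x \<in> unit_disc" "e u = h x" using eH[OF \<open>Re u > 0\<close>] H(2) by blast
    then show ?thesis using g by (simp add: G_def)
  qed
  define r where "r = \<sigma> * (Im (h z) - \<alpha>)"
  have r: "r > 0" using z(2) by (simp add: r_def H_eq)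
  have "hyp_dist z w \<le> ln (1 + \<bar>t\<bar> / r)" if w: "w \<in> unit_disc" and hw: "h w = h z + of_real t" for w t
  proof -
    define a where "a = - \<i> * of_real \<sigma> * (h z - \<i> * of_real \<alpha>)"
    define b where "b = a - \<i> * of_real (\<sigma> * t)"
    have Re: "Re a = r" "Re b = r" by (simp_all add: a_def b_def r_def)
    have ea: "e a = h z" and eb: "e b = h w"
      using \<sigma> hw by (auto simp: e_def a_def b_def algebra_simps)
    have Ga: "G a = z" "G b = w" using g z(1) w by (simp_all add: G_def ea eb)
    have "cmod ((w - z) / (1 - cnj z * w)) \<le> cmod ((b - a) / (b + cnj a))"
      using schwarz_pick_half_plane_to_disc[OF holG discG, of a b] Re r Ga by simp
    also have "\<dots> = \<bar>t\<bar> / sqrt (4 * r\<^sup>2 + \<bar>t\<bar>\<^sup>2)"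
    proof -
      have "cmod (b - a) = \<bar>t\<bar>" using \<sigma> by (auto simp: b_def norm_mult)
      moreover have "b + cnj a = Complex (2 * r) (- \<sigma> * t)"
        using Re by (simp add: complex_eq_iff b_def)
      then have "cmod (b + cnj a) = sqrt (4 * r\<^sup>2 + \<bar>t\<bar>\<^sup>2)"
        using \<sigma> by (auto simp: complex_norm power_mult_distrib)
      ultimately show ?thesis by (simp add: norm_divide)
    qed
    finally show ?thesis
      unfolding hyp_dist_def norm_divide norm_minus_commute[of z w]
      by (intro artanh_le_log[OF r]) auto
  qed
  then show ?thesis using r that by blast
qed

section \<open>Parabolic petals in the Koenigs coordinate\<close>

text \<open>A horizontal half-plane is invariant under translation by negative \<open>t\<close> too, so
  \<open>h z + t\<close> has a preimage \<open>\<zeta>\<close> in the petal; injectivity of \<open>h\<close> gives \<open>\<phi> (- t) \<zeta> = z\<close>. Thus \<open>z\<close> is in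
  the range on which the inverse in \<open>petal_flow\<close> is meaningful.\<close>

lemma koenigs_petal_flow:
  assumes self: "\<And>s x. s \<ge> 0 \<Longrightarrow> x \<in> unit_disc \<Longrightarrow> \<phi> s x \<in> unit_disc"
    and koenigs: "koenigs_function \<phi> h"
    and sub: "\<Delta> \<subseteq> unit_disc" and H: "horizontal_half_plane (h ` \<Delta>)"
    and z: "z \<in> \<Delta>" and t: "t < 0"
  shows "petal_flow \<phi> \<Delta> t z \<in> unit_disc" "h (petal_flow \<phi> \<Delta> t z) = h z + of_real t"
proof -
  have inj: "inj_on h unit_disc"
    and flow: "\<And>x s. x \<in> unit_disc \<Longrightarrow> s \<ge> 0 \<Longrightarrow> h (\<phi> s x) = h x + of_real s"
    using koenigs by (auto simp: koenigs_function_def)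
  obtain \<zeta> where \<zeta>: "\<zeta> \<in> \<Delta>" "h \<zeta> = h z + of_real t"
  proof -
    have "Im (h z + of_real t) = Im (h z)" by simp
    then have "h z + of_real t \<in> h ` \<Delta>"
      using H z unfolding horizontal_half_plane_def by (metis (mono_tags, lifting) imageI mem_Collect_eq)
    then show ?thesis using that by (metis imageE)
  qed
  have "\<phi> (- t) \<zeta> = z"
    by (rule inj_onD[OF inj]) (use flow[of \<zeta> "- t"] \<zeta> sub z t self in auto)
  then have "z \<in> \<phi> (- t) ` \<Delta>" using \<zeta> by blast
  then have "petal_flow \<phi> \<Delta> t z \<in> \<Delta>" "\<phi> (- t) (petal_flow \<phi> \<Delta> t z) = z"
    using t by (simp_all add: petal_flow_def inv_into_into f_inv_into_f)
  then show "petal_flow \<phi> \<Delta> t z \<in> unit_disc" "h (petal_flow \<phi> \<Delta> t z) = h z + of_real t"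
    using flow[of "petal_flow \<phi> \<Delta> t z" "- t"] sub t by auto
qed

text \<open>If \<open>\<Omega>\<close> were the whole plane, the half-plane obtained by shifting the boundary line of \<open>H\<close>
  outwards by one would contradict maximality.\<close>

lemma maximal_half_plane_omits_point:
  assumes "maximal_horizontal_half_plane \<Omega> H"
  obtains p where "p \<notin> \<Omega>"
proof -
  have half: "horizontal_half_plane H"
    and max: "\<forall>H'. horizontal_half_plane H' \<and> H \<subseteq> H' \<and> H' \<subseteq> \<Omega> \<longrightarrow> H' = H"
    using assms unfolding maximal_horizontal_half_plane_def by simp_all
  obtain a where a: "H = {w. Im w > a} \<or> H = {w. Im w < a}"
    using half unfolding horizontal_half_plane_def by (rule exE)
  have "\<exists>H'. horizontal_half_plane H' \<and> H \<subseteq> H' \<and> Complex 0 a \<in> H' \<and> Complex 0 a \<notin> H"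
    using a
  proof
    assume H: "H = {w. Im w > a}"
    have "horizontal_half_plane {w. Im w > a - 1}"
      unfolding horizontal_half_plane_def by blast
    moreover have "H \<subseteq> {w. Im w > a - 1}" unfolding H by (rule Collect_mono) simp
    ultimately show ?thesis unfolding H by (intro exI[of _ "{w. Im w > a - 1}"]) simp
  next
    assume H: "H = {w. Im w < a}"
    have "horizontal_half_plane {w. Im w < a + 1}"
      unfolding horizontal_half_plane_def by blast
    moreover have "H \<subseteq> {w. Im w < a + 1}" unfolding H by (rule Collect_mono) simp
    ultimately show ?thesis unfolding H by (intro exI[of _ "{w. Im w < a + 1}"]) simp
  qed
  then obtain H' where H': "horizontal_half_plane H'" "H \<subseteq> H'" "Complex 0 a \<in> H'"
    and notin: "Complex 0 a \<notin> H" by blast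
  have "\<not> H' \<subseteq> \<Omega>" using max H' notin by metis
  then show ?thesis using that by blast
qed

section \<open>From additive to multiplicative constants\<close>

text \<open>Far out, the additive constants \<open>B\<close> and \<open>C\<close> are a small part of \<open>ln \<bar>t\<bar>\<close>, which gives the
  universal factor \<open>8\<close>. For all \<open>t < -1\<close>, the bound \<open>v \<ge> \<delta>\<close> allows \<open>C \<le> (C / \<delta>) v\<close>, so \<open>C\<close> can be
  moved into the factor. In the upper bound \<open>B\<close> is moved into the factor in the same way by
  \<open>ln \<bar>t\<bar> \<ge> ln \<bar>T\<bar> > 0\<close>; this requires \<open>t\<close> to stay away from \<open>-1\<close>, where the logarithm vanishes and
  the speed does not.\<close>

lemma log_comparison:
  fixes v :: "real \<Rightarrow> real"
  assumes \<delta>: "\<delta> > 0" and C: "C \<ge> 0" and B: "B \<ge> 0"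
    and low: "\<And>t. t < - 1 \<Longrightarrow> \<delta> \<le> v t"
    and log_low: "\<And>t. t < - 1 \<Longrightarrow> ln \<bar>t\<bar> / 4 - C \<le> v t"
    and up: "\<And>t. t < - 1 \<Longrightarrow> v t \<le> ln \<bar>t\<bar> + B"
  shows "\<exists>T< -1. \<forall>t<T. 1 / 8 * ln \<bar>t\<bar> \<le> v t \<and> v t \<le> 8 * ln \<bar>t\<bar>"
    and "\<forall>T< -1. \<exists>c'\<ge>1. (\<forall>t< -1. 1 / c' * ln \<bar>t\<bar> \<le> v t) \<and> (\<forall>t\<le>T. v t \<le> c' * ln \<bar>t\<bar>)"
proof -
  show "\<exists>T< -1. \<forall>t<T. 1 / 8 * ln \<bar>t\<bar> \<le> v t \<and> v t \<le> 8 * ln \<bar>t\<bar>"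
  proof (intro exI conjI allI impI)
    \<comment> \<open>Beyond this point \<open>C \<le> ln \<bar>t\<bar> / 8\<close> and \<open>B \<le> ln \<bar>t\<bar>\<close>.\<close>
    show T: "- exp (8 * C + B + 1) < - 1" using C B by simp
    fix t :: real
    assume t: "t < - exp (8 * C + B + 1)"
    then have t1: "t < - 1" using T by linarith
    have "ln (exp (8 * C + B + 1)) \<le> ln \<bar>t\<bar>" using t by (intro ln_mono) auto
    then have ln: "8 * C + B + 1 \<le> ln \<bar>t\<bar>" by simp
    show "1 / 8 * ln \<bar>t\<bar> \<le> v t" using log_low[OF t1] ln B by simp
    show "v t \<le> 8 * ln \<bar>t\<bar>" using up[OF t1] ln B C by simp
  qed
  show "\<forall>T< -1. \<exists>c'\<ge>1. (\<forall>t< -1. 1 / c' * ln \<bar>t\<bar> \<le> v t) \<and> (\<forall>t\<le>T. v t \<le> c' * ln \<bar>t\<bar>)"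
  proof (intro allI impI)
    fix T :: real
    assume T: "T < - 1"
    define l where "l = ln \<bar>T\<bar>"
    have l: "l > 0" using T by (simp add: l_def)
    define c' where "c' = 4 * (1 + C / \<delta>) + (1 + B / l)"
    have c1: "c' \<ge> 1" and cl: "c' \<ge> 4 * (1 + C / \<delta>)" and cu: "c' \<ge> 1 + B / l"
      using \<delta> C B l by (simp_all add: c'_def)
    have "1 / c' * ln \<bar>t\<bar> \<le> v t" if t: "t < - 1" for t
    proof -
      have v: "v t > 0" using low[OF t] \<delta> by simp
      have "C \<le> C / \<delta> * v t" using mult_left_mono[OF low[OF t], of "C / \<delta>"] \<delta> C by simp
      then have "ln \<bar>t\<bar> \<le> 4 * (1 + C / \<delta>) * v t" using log_low[OF t] by (simp add: distrib_left distrib_right)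
      also have "\<dots> \<le> c' * v t" using cl v by (intro mult_right_mono) auto
      finally show ?thesis using c1 by (simp add: field_simps)
    qed
    moreover have "v t \<le> c' * ln \<bar>t\<bar>" if t: "t \<le> T" for t
    proof -
      have lt: "l \<le> ln \<bar>t\<bar>" unfolding l_def using t T by (intro ln_mono) auto
      have "B \<le> B / l * ln \<bar>t\<bar>" using mult_left_mono[OF lt, of "B / l"] l B by simp
      then have "v t \<le> (1 + B / l) * ln \<bar>t\<bar>" using up[of t] t T by (simp add: algebra_simps)
      also have "\<dots> \<le> c' * ln \<bar>t\<bar>" using cu lt l by (intro mult_right_mono) auto
      finally show ?thesis .
    qed
    ultimately show "\<exists>c'\<ge>1. (\<forall>t< -1. 1 / c' * ln \<bar>t\<bar> \<le> v t) \<and> (\<forall>t\<le>T. v t \<le> c' * ln \<bar>t\<bar>)"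
      using c1 by blast
  qed
qed

theorem theorem4p2:
  "\<exists>c::real. c \<ge> 1 \<and>
     (\<forall>\<phi> \<Delta> z. hol_semigroup \<phi> \<and> \<not> is_hol_group \<phi> \<and> parabolic_petal \<phi> \<Delta> \<and> z \<in> \<Delta> \<longrightarrow>
        (\<exists>T< -1. \<forall>t<T. 1 / c * ln \<bar>t\<bar> \<le> total_speed \<phi> \<Delta> z t \<and>
                      total_speed \<phi> \<Delta> z t \<le> c * ln \<bar>t\<bar>) \<and>
        (\<forall>T< -1. \<exists>c'\<ge>1. (\<forall>t< -1. 1 / c' * ln \<bar>t\<bar> \<le> total_speed \<phi> \<Delta> z t) \<and>
                         (\<forall>t\<le>T. total_speed \<phi> \<Delta> z t \<le> c' * ln \<bar>t\<bar>)))"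
proof (rule exI[of _ 8], intro conjI[of "8 \<ge> (1::real)"] allI impI)
  fix \<phi> \<Delta> z
  assume asm: "hol_semigroup \<phi> \<and> \<not> is_hol_group \<phi> \<and> parabolic_petal \<phi> \<Delta> \<and> z \<in> \<Delta>"
  then have z: "z \<in> \<Delta>" by blast
  have self: "\<phi> s x \<in> unit_disc" if "s \<ge> 0" "x \<in> unit_disc" for s x
    using asm that unfolding hol_semigroup_def by blast
  obtain h where koenigs: "koenigs_function \<phi> h"
    and max: "maximal_horizontal_half_plane (h ` unit_disc) (h ` \<Delta>)"
    using asm unfolding parabolic_petal_def by blast
  have holh: "h holomorphic_on unit_disc" and inj: "inj_on h unit_disc"
    and flow: "\<And>x s. x \<in> unit_disc \<Longrightarrow> s \<ge> 0 \<Longrightarrow> h (\<phi> s x) = h x + of_real s"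
    using koenigs by (auto simp: koenigs_function_def)
  have half: "horizontal_half_plane (h ` \<Delta>)" "h ` \<Delta> \<subseteq> h ` unit_disc"
    using max by (auto simp: maximal_horizontal_half_plane_def)
  have sub: "\<Delta> \<subseteq> unit_disc"
  proof -
    have "\<Delta> \<subseteq> backward_invariant_set \<phi>"
      using asm in_components_subset interior_subset
      unfolding parabolic_petal_def petal_def by blast
    also have "\<dots> \<subseteq> \<phi> 0 ` unit_disc" unfolding backward_invariant_set_def by auto
    also have "\<dots> \<subseteq> unit_disc" using self by blast
    finally show ?thesis .
  qed
  obtain p where p: "p \<notin> h ` unit_disc" using maximal_half_plane_omits_point[OF max] .
  \<comment> \<open>A point \<open>p - s\<close> of the image would flow to \<open>p\<close> in time \<open>s\<close>.\<close>
  have omit: "h x \<noteq> p - of_real s" if "x \<in> unit_disc" "s \<ge> 0" for x s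
  proof
    assume "h x = p - of_real s"
    then have "h (\<phi> s x) = p" using flow[OF that] by simp
    then show False using p self[OF that(2,1)] by blast
  qed
  have zD: "z \<in> unit_disc" "h z \<in> h ` \<Delta>" using z sub by auto
  define v where "v t = total_speed \<phi> \<Delta> z t" for t
  define \<zeta> where "\<zeta> t = petal_flow \<phi> \<Delta> t z" for t
  have \<zeta>: "\<zeta> t \<in> unit_disc" "h (\<zeta> t) = h z + of_real t" if "t < 0" for t
    unfolding \<zeta>_def using koenigs_petal_flow[OF self koenigs sub half(1) z that] by blast+
  have v: "v t = hyp_dist z (\<zeta> t)" for t by (simp add: v_def \<zeta>_def total_speed_def)
  have dist: "cmod (h z - h (\<zeta> t)) = \<bar>t\<bar>" if "t < 0" for t
    using \<zeta>(2)[OF that] by simp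
  obtain \<delta> C where \<delta>: "\<delta> > 0" and C: "C \<ge> 0"
    and low: "\<And>w. w \<in> unit_disc \<Longrightarrow> cmod (h z - h w) \<ge> 1 \<Longrightarrow> \<delta> \<le> hyp_dist z w"
    and log_low: "\<And>w. w \<in> unit_disc \<Longrightarrow> cmod (h z - h w) \<ge> 1 \<Longrightarrow>
        ln (cmod (h z - h w)) / 4 - C \<le> hyp_dist z w"
    using hyp_dist_ge_log_of_slit_omitted[OF holh omit zD(1)] by metis
  obtain r where r: "r > 0" and up: "\<And>w t. w \<in> unit_disc \<Longrightarrow> h w = h z + of_real t \<Longrightarrow>
      hyp_dist z w \<le> ln (1 + \<bar>t\<bar> / r)"
    using hyp_dist_le_log_of_half_plane_in_image[OF holh inj half zD] by metis
  have bounds: "\<delta> \<le> v t" "ln \<bar>t\<bar> / 4 - C \<le> v t" "v t \<le> ln \<bar>t\<bar> + ln (1 + 1 / r)"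
    if t: "t < - 1" for t
  proof -
    have t0: "t < 0" using t by simp
    show "\<delta> \<le> v t" "ln \<bar>t\<bar> / 4 - C \<le> v t"
      using low[OF \<zeta>(1)[OF t0]] log_low[OF \<zeta>(1)[OF t0]] dist[OF t0] t by (simp_all add: v)
    have "v t \<le> ln (1 + \<bar>t\<bar> / r)" unfolding v by (rule up[OF \<zeta>[OF t0]])
    also have "\<dots> \<le> ln (\<bar>t\<bar> * (1 + 1 / r))"
      using t r by (intro ln_mono) (auto simp: algebra_simps add_pos_pos)
    also have "\<dots> = ln \<bar>t\<bar> + ln (1 + 1 / r)"
      using t r by (intro ln_mult_pos) (auto simp: add_pos_pos)
    finally show "v t \<le> ln \<bar>t\<bar> + ln (1 + 1 / r)" .
  qed
  have "ln (1 + 1 / r) \<ge> 0" using r by simp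
  from log_comparison[OF \<delta> C this bounds]
  show "(\<exists>T< -1. \<forall>t<T. 1 / 8 * ln \<bar>t\<bar> \<le> total_speed \<phi> \<Delta> z t \<and>
            total_speed \<phi> \<Delta> z t \<le> 8 * ln \<bar>t\<bar>) \<and>
        (\<forall>T< -1. \<exists>c'\<ge>1. (\<forall>t< -1. 1 / c' * ln \<bar>t\<bar> \<le> total_speed \<phi> \<Delta> z t) \<and>
            (\<forall>t\<le>T. total_speed \<phi> \<Delta> z t \<le> c' * ln \<bar>t\<bar>))"
    unfolding v_def by (rule conjI)
qed simp

end
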